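(* (Validity of the syllogisms of Figure I.) Let $S,M,P$ be three logically independent events. Then the following probabilistic inferences hold, where $\models_s$ denotes strict validity and $\models$ denotes validity: \begin{itemize} \item (Barbara) $(p(P|M)=1,\ p(M|S)=1,\ p(S|(S\vee M))>0)\ \models_s\ p(P|S)=1$; \item (Barbari) $(p(P|M)=1,\ p(M|S)=1,\ p(S|(S\vee M))>0)\ \models\ p(P|S)>0$, and this inference is not strictly valid; \item (Darii) $(p(P|M)=1,\ p(M|S)>0,\ p(S|(S\vee M))>0)\ \models_s\ p(P|S)>0$; \item (Celarent) $(p(P|M)=0,\ p(M|S)=1,\ p(S|(S\vee M))>0)\ \models_s\ p(P|S)=0$; \item (Celaront) $(p(P|M)=0,\ p(M|S)=1,\ p(S|(S\vee M))>0)\ \models\ p(\overline{P}|S)>0$, and this inference is not strictly valid; \item (Ferio) $(p(P|M)=0,\ p(M|S)>0,\ p(S|(S\vee M))>0)\ \models_s\ p(\overline{P}|S)>0$. \end{itemize}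
   Context: Events are elements of a Boolean algebra (e.g. subsets of a set $\Omega$), identified with their $\{0,1\}$-valued indicators; $\overline{E}$ is the negation of $E$ and juxtaposition or $\wedge$ is conjunction. Three events are logically independent if all $8$ conjunctions obtained by choosing each of them or its negation are different from the impossible event $\bot$. For events $E,H$ with $H\ne\bot$, the conditional event $E|H$ is true if $EH$ is true, false if $\overline{E}H$ is true, and void if $H$ is false. Coherence: an assessment $\mathcal P=(p_1,\dots,p_n)\in\mathbb R^n$ on $\mathcal F=(E_1|H_1,\dots,E_n|H_n)$ is coherent if for every nonempty $J\subseteq\{1,\dots,n\}$ and all real numbers $s_j$ ($j\in J$), the random gain $G=\sum_{j\in J}s_jH_j(E_j-p_j)$, restricted to $\bigvee_{j\in J}H_j$ (i.e. considering only its values when at least one $H_j$, $j\in J$, is true), has minimum $\le 0$ and maximum $\ge 0$. An imprecise assessment on $\mathcal F$ is a set $\mathcal I\subseteq[0,1]^n$; it is g-coherent if it contains at least one coherent assessment. The set $\Sigma$ of coherent extensions of $\mathcal I$ to a further conditional event $E_{n+1}|H_{n+1}$ is the set of all $z\in[0,1]$ such that, for some coherent $\mathcal P\in\mathcal I$, the assessment $(\mathcal P,z)$ on $(\mathcal F,E_{n+1}|H_{n+1})$ is coherent. For a g-coherent $\mathcal I$ on $\mathcal F$ and a nonempty $\mathcal I'\subseteq[0,1]$, the inference "from $\mathcal I$ on $\mathcal F$ infer $\mathcal I'$ on $E_{n+1}|H_{n+1}$" is valid ($\models$) if $\Sigma\subseteq\mathcal I'$, and strictly valid ($\models_s$) if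 $\Sigma=\mathcal I'$. A list of constraints $p(E_i|H_i)\in\mathcal I_i$ stands for the imprecise assessment $\mathcal I_1\times\cdots\times\mathcal I_n$; all probabilities range in $[0,1]$, so "$=1$" is $\{1\}$, "$=0$" is $\{0\}$, and "$>0$" is $(0,1]$. A conclusion $p(\overline{P}|S)\in\mathcal I'$ is an assessment on $\overline{P}|S$. *)

theory Defs
  imports Complex_Main
begin

unbundle lattice_syntax

definition logically_independent3 :: "'a::boolean_algebra \<Rightarrow> 'a \<Rightarrow> 'a \<Rightarrow> bool" where
  "logically_independent3 A B C \<longleftrightarrow>
     (\<forall>X\<in>{A, - A}. \<forall>Y\<in>{B, - B}. \<forall>Z\<in>{C, - C}. X \<sqinter> Y \<sqinter> Z \<noteq> \<bottom>)"

text \<open>The requirement that the conditioning event differs from \<^term>\<open>\<bottom>\<close> is part of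
  \<open>coherent\<close> below; as a subtype it would be empty over the degenerate algebra.\<close>

datatype 'a cond_event = Given (ev: 'a) (hyp: 'a)  (infix "given" 50)

text \<open>A truth assignment \<open>v\<close> to a finite nonempty set \<open>A\<close> of events is possible if the
  conjunction of the events, each affirmed or negated according to \<open>v\<close>, is not the impossible
  event. The indicator of an event \<open>a \<in> A\<close> then has the value \<open>of_bool (v a)\<close>. In a general
  Boolean algebra (without points) these assignments play the role of the elements of the sample
  space; only the values of \<open>v\<close> on \<open>A\<close> matter.\<close>

definition possible :: "'a::boolean_algebra set \<Rightarrow> ('a \<Rightarrow> bool) \<Rightarrow> bool" where
  "possible A v \<longleftrightarrow> \<Sqinter>\<^sub>f\<^sub>i\<^sub>n ((\<lambda>a. if v a then a else - a) ` A) \<noteq> \<bottom>"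

definition gain ::
  "'a cond_event list \<Rightarrow> real list \<Rightarrow> nat set \<Rightarrow> (nat \<Rightarrow> real) \<Rightarrow> ('a \<Rightarrow> bool) \<Rightarrow> real" where
  "gain F p J s v =
     (\<Sum>j\<in>J. s j * of_bool (v (hyp (F ! j))) * (of_bool (v (ev (F ! j))) - p ! j))"

text \<open>The values of the gain when at least one conditioning event is true.\<close>

definition gain_values ::
  "'a::boolean_algebra cond_event list \<Rightarrow> real list \<Rightarrow> nat set \<Rightarrow> (nat \<Rightarrow> real) \<Rightarrow> real set" where
  "gain_values F p J s =
     gain F p J s ` {v. possible (\<Union>j\<in>J. {ev (F ! j), hyp (F ! j)}) v \<and> (\<exists>j\<in>J. v (hyp (F ! j)))}"

definition coherent :: "'a::boolean_algebra cond_event list \<Rightarrow> real list \<Rightarrow> bool" where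
  "coherent F p \<longleftrightarrow>
     length p = length F \<and> (\<forall>j<length F. hyp (F ! j) \<noteq> \<bottom>) \<and>
     (\<forall>J s. J \<noteq> {} \<and> J \<subseteq> {..<length F} \<longrightarrow>
        Min (gain_values F p J s) \<le> 0 \<and> 0 \<le> Max (gain_values F p J s))"

definition imprecise_assessment :: "'a cond_event list \<Rightarrow> real list set \<Rightarrow> bool" where
  "imprecise_assessment F I \<longleftrightarrow> (\<forall>p\<in>I. length p = length F \<and> set p \<subseteq> {0..1})"

definition g_coherent :: "'a::boolean_algebra cond_event list \<Rightarrow> real list set \<Rightarrow> bool" where
  "g_coherent F I \<longleftrightarrow> imprecise_assessment F I \<and> (\<exists>p\<in>I. coherent F p)"

definition coherent_extensions ::
  "'a::boolean_algebra cond_event list \<Rightarrow> real list set \<Rightarrow> 'a cond_event \<Rightarrow> real set" where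
  "coherent_extensions F I C =
     {z \<in> {0..1}. \<exists>p\<in>I. coherent F p \<and> coherent (F @ [C]) (p @ [z])}"

text \<open>The standing requirements on an inference (g-coherent premises, nonempty set of values for
  the conclusion) are part of both notions of validity.\<close>

definition valid ::
  "'a::boolean_algebra cond_event list \<Rightarrow> real list set \<Rightarrow> 'a cond_event \<Rightarrow> real set \<Rightarrow> bool" where
  "valid F I C I' \<longleftrightarrow>
     g_coherent F I \<and> I' \<noteq> {} \<and> I' \<subseteq> {0..1} \<and> coherent_extensions F I C \<subseteq> I'"

definition strictly_valid ::
  "'a::boolean_algebra cond_event list \<Rightarrow> real list set \<Rightarrow> 'a cond_event \<Rightarrow> real set \<Rightarrow> bool" where
  "strictly_valid F I C I' \<longleftrightarrow>
     g_coherent F I \<and> I' \<noteq> {} \<and> I' \<subseteq> {0..1} \<and> coherent_extensions F I C = I'"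

text \<open>\<^const>\<open>Min\<close> and \<^const>\<open>Max\<close> in \<^const>\<open>coherent\<close> are applied to finite nonempty sets.\<close>

lemma finite_gain_values:
  assumes "finite J"
  shows "finite (gain_values F p J s)"
proof -
  let ?g = "\<lambda>(A, B). \<Sum>j\<in>J. s j * of_bool (j \<in> A) * (of_bool (j \<in> B) - p ! j)"
  have "gain F p J s v = ?g ({j\<in>J. v (hyp (F ! j))}, {j\<in>J. v (ev (F ! j))})" for v
    unfolding gain_def by (auto intro!: sum.cong)
  then have "gain_values F p J s \<subseteq> ?g ` (Pow J \<times> Pow J)"
    unfolding gain_values_def by blast
  then show ?thesis
    by (rule finite_subset) (use assms in simp)
qed

lemma split_by_event:
  fixes x :: "'a::boolean_algebra"
  assumes "x \<noteq> \<bottom>"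
  shows "x \<sqinter> a \<noteq> \<bottom> \<or> x \<sqinter> - a \<noteq> \<bottom>"
proof -
  have "x = (x \<sqinter> a) \<squnion> (x \<sqinter> - a)"
    by (simp flip: inf_sup_distrib1)
  with assms show ?thesis by auto
qed

lemma possible_below:
  fixes x :: "'a::boolean_algebra"
  assumes "finite A" "A \<noteq> {}" "x \<noteq> \<bottom>"
  shows "\<exists>v. x \<sqinter> \<Sqinter>\<^sub>f\<^sub>i\<^sub>n ((\<lambda>a. if v a then a else - a) ` A) \<noteq> \<bottom>"
  using assms
proof (induction A arbitrary: x rule: finite_ne_induct)
  case (singleton a)
  show ?case
  proof (cases "x \<sqinter> a = \<bottom>")
    case True
    then have "x \<sqinter> - a \<noteq> \<bottom>"
      using split_by_event[OF singleton] by blast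
    then show ?thesis by (intro exI[of _ "\<lambda>_. False"]) simp
  next
    case False
    then show ?thesis by (intro exI[of _ "\<lambda>_. True"]) simp
  qed
next
  case (insert a A)
  obtain b where b: "x \<sqinter> (if b then a else - a) \<noteq> \<bottom>"
    using split_by_event[OF insert.prems, of a] by (metis (full_types))
  from insert.IH[OF b] obtain v where
    v: "x \<sqinter> (if b then a else - a) \<sqinter> \<Sqinter>\<^sub>f\<^sub>i\<^sub>n ((\<lambda>a. if v a then a else - a) ` A) \<noteq> \<bottom>"
    by blast
  have eq: "(\<lambda>c. if (v(a := b)) c then c else - c) ` A = (\<lambda>c. if v c then c else - c) ` A"
    using insert.hyps by (intro image_cong) auto
  have "\<Sqinter>\<^sub>f\<^sub>i\<^sub>n ((\<lambda>c. if (v(a := b)) c then c else - c) ` insert a A)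
      = (if b then a else - a) \<sqinter> \<Sqinter>\<^sub>f\<^sub>i\<^sub>n ((\<lambda>c. if v c then c else - c) ` A)"
    unfolding image_insert eq using insert.hyps by (subst Inf_fin.insert) auto
  with v show ?case by (intro exI[of _ "v(a := b)"]) (simp add: inf_assoc)
qed

lemma gain_values_nonempty:
  assumes "finite J" "j \<in> J" "hyp (F ! j) \<noteq> \<bottom>"
  shows "gain_values F p J s \<noteq> {}"
proof -
  let ?A = "\<Union>j\<in>J. {ev (F ! j), hyp (F ! j)}"
  have fin: "finite ?A" and mem: "hyp (F ! j) \<in> ?A"
    using assms by auto
  obtain v where v: "hyp (F ! j) \<sqinter> \<Sqinter>\<^sub>f\<^sub>i\<^sub>n ((\<lambda>a. if v a then a else - a) ` ?A) \<noteq> \<bottom>"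
    using possible_below[OF fin _ assms(3)] mem by blast
  have "possible ?A v"
    using v unfolding possible_def by auto
  moreover have "v (hyp (F ! j))"
  proof (rule ccontr)
    assume "\<not> v (hyp (F ! j))"
    then have "- hyp (F ! j) \<in> (\<lambda>a. if v a then a else - a) ` ?A"
      using mem by (auto intro!: rev_image_eqI)
    then have "\<Sqinter>\<^sub>f\<^sub>i\<^sub>n ((\<lambda>a. if v a then a else - a) ` ?A) \<le> - hyp (F ! j)"
      using fin by (intro Inf_fin.coboundedI) auto
    with v show False by (simp add: inf_shunt inf_commute compl_le_swap1)
  qed
  ultimately show ?thesis
    using assms(2) unfolding gain_values_def by blast
qed

end

theory Submission
  imports Defs
begin

text \<open>All six syllogisms rest on one computation. If \<open>p(P|M) = 1\<close>, \<open>p(M|S) = y\<close> and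
  \<open>p(S|S \<or> M) > 0\<close>, the coherent values of \<open>p(P|S)\<close> are exactly those in \<open>[y, 1]\<close>.

  The lower bound is the inequality \<open>p(P|S) \<ge> p(P \<and> M|S) = p(M|S)\<close>, which needs \<open>S\<close> to have
  positive probability given \<open>S \<or> M\<close>; in betting terms, a value \<open>z < y\<close> is refuted by stakes for
  which the gain is negative in every case (\<open>syllogism_lower_bound\<close>). Conversely every \<open>z\<close> in
  \<open>[y, 1]\<close> is realised by a probability distribution on the constituents generated by \<open>S\<close>, \<open>M\<close>
  and \<open>P\<close> that makes both \<open>S\<close> and \<open>M\<close> positive (\<open>coherent_syllogism\<close>). That is enough for
  coherence, since the gain of any bet then has conditional expectation zero
  (\<open>coherent_if_distribution\<close>).

  Letting \<open>y\<close> range over \<open>{1}\<close> gives Barbara and Barbari, and letting it range over the positive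
  values gives Darii. The negative syllogisms are the same statements about \<open>\<not> P\<close>: assessing \<open>E|H\<close>
  with \<open>x\<close> is equivalent to assessing \<open>\<not> E|H\<close> with \<open>1 - x\<close>
  (\<open>coherent_negate_event\<close>). Negating the first premise yields Celaront and Ferio; negating the
  conclusion as well yields Celarent.\<close>

section \<open>Possible truth assignments\<close>

abbreviation literal :: "('a::boolean_algebra \<Rightarrow> bool) \<Rightarrow> 'a \<Rightarrow> 'a" where
  "literal v a \<equiv> if v a then a else - a"

lemma possible_antimono:
  assumes "possible B v" "A \<subseteq> B" "A \<noteq> {}" "finite B"
  shows "possible A v"
proof -
  have "\<Sqinter>\<^sub>f\<^sub>i\<^sub>n (literal v ` B) \<le> \<Sqinter>\<^sub>f\<^sub>i\<^sub>n (literal v ` A)"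
    using assms by (intro Inf_fin.subset_imp) auto
  with assms(1) show ?thesis
    unfolding possible_def using bot.extremum_uniqueI by metis
qed

lemma possible_literals:
  assumes "possible A v" "finite A" "a \<in> A" "b \<in> A" "c \<in> A"
  shows "literal v a \<sqinter> literal v b \<sqinter> literal v c \<noteq> \<bottom>"
proof -
  have "\<Sqinter>\<^sub>f\<^sub>i\<^sub>n (literal v ` A) \<le> literal v d" if "d \<in> A" for d
    using assms(2) that by (intro Inf_fin.coboundedI) auto
  then have "\<Sqinter>\<^sub>f\<^sub>i\<^sub>n (literal v ` A) \<le> literal v a \<sqinter> literal v b \<sqinter> literal v c"
    using assms(3-5) by (intro inf_greatest)
  with assms(1) show ?thesis
    unfolding possible_def using bot.extremum_uniqueI by metis
qed

lemma possible_true_nonbot: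
  assumes "possible A v" "finite A" "a \<in> A" "v a"
  shows "a \<noteq> \<bottom>"
  using possible_literals[OF assms(1,2,3,3,3)] assms(4) by simp

lemma possible_uminus:
  assumes "possible A v" "finite A" "a \<in> A" "- a \<in> A"
  shows "v (- a) \<longleftrightarrow> \<not> v a"
  using possible_literals[OF assms(1,2,3,4,4)] by (auto split: if_splits)

lemma possible_sup:
  assumes "possible A v" "finite A" "a \<in> A" "b \<in> A" "a \<squnion> b \<in> A"
  shows "v (a \<squnion> b) \<longleftrightarrow> v a \<or> v b"
proof -
  have "a \<sqinter> b \<sqinter> - (a \<squnion> b) = \<bottom>" "a \<sqinter> - b \<sqinter> - (a \<squnion> b) = \<bottom>"
    "- a \<sqinter> b \<sqinter> - (a \<squnion> b) = \<bottom>" "- a \<sqinter> - b \<sqinter> (a \<squnion> b) = \<bottom>"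
    by (simp_all add: inf_shunt sup_assoc le_supI1 le_supI2)
  then show ?thesis
    using possible_literals[OF assms] by (auto split: if_splits)
qed

text \<open>In an algebra without points, a nonzero element \<open>x\<close> still behaves like a sample point as far
  as finitely many events are concerned: it can be refined until each of them is decided.\<close>

lemma possible_deciding:
  fixes x :: "'a::boolean_algebra"
  assumes "finite A" "A \<noteq> {}" "x \<noteq> \<bottom>"
  obtains v where "possible A v" "\<And>a. a \<in> A \<Longrightarrow> x \<le> a \<Longrightarrow> v a" "\<And>a. a \<in> A \<Longrightarrow> x \<le> - a \<Longrightarrow> \<not> v a"
proof -
  obtain v where v: "x \<sqinter> \<Sqinter>\<^sub>f\<^sub>i\<^sub>n (literal v ` A) \<noteq> \<bottom>"
    using possible_below[OF assms] by blast
  have lit: "x \<sqinter> literal v a \<noteq> \<bottom>" if "a \<in> A" for a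
  proof -
    have "\<Sqinter>\<^sub>f\<^sub>i\<^sub>n (literal v ` A) \<le> literal v a"
      using assms(1) that by (intro Inf_fin.coboundedI) auto
    with v show ?thesis
      by (metis bot.extremum_uniqueI inf_mono order_refl)
  qed
  show thesis
  proof
    show "possible A v"
      using v unfolding possible_def by auto
    show "v a" if "a \<in> A" "x \<le> a" for a
      using lit[OF that(1)] that(2) by (auto simp: inf_shunt split: if_splits)
    show "\<not> v a" if "a \<in> A" "x \<le> - a" for a
      using lit[OF that(1)] that(2) by (auto simp: inf_shunt split: if_splits)
  qed
qed

lemma possible_extend:
  assumes "possible A v" "finite A" "A \<noteq> {}" "finite B"
  obtains v' where "possible (A \<union> B) v'" "\<And>a. a \<in> A \<Longrightarrow> v' a = v a"
proof -
  let ?x = "\<Sqinter>\<^sub>f\<^sub>i\<^sub>n (literal v ` A)"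
  have x: "?x \<le> literal v a" if "a \<in> A" for a
    using assms(2) that by (intro Inf_fin.coboundedI) auto
  obtain v' where v': "possible (A \<union> B) v'"
    "\<And>a. a \<in> A \<union> B \<Longrightarrow> ?x \<le> a \<Longrightarrow> v' a" "\<And>a. a \<in> A \<union> B \<Longrightarrow> ?x \<le> - a \<Longrightarrow> \<not> v' a"
    using possible_deciding[of "A \<union> B" ?x] assms unfolding possible_def by blast
  have "v' a = v a" if "a \<in> A" for a
    using x[OF that] v'(2,3)[of a] that by (cases "v a") auto
  with v'(1) show thesis by (rule that)
qed

section \<open>Coherence\<close>

abbreviation events :: "'a cond_event list \<Rightarrow> nat set \<Rightarrow> 'a set" where
  "events F J \<equiv> \<Union>j\<in>J. {ev (F ! j), hyp (F ! j)}"

lemma gain_cong: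
  assumes "\<And>a. a \<in> events F J \<Longrightarrow> v' a = v a"
  shows "gain F p J s v' = gain F p J s v"
  unfolding gain_def using assms by (intro sum.cong) auto

text \<open>The contrapositive refutes an assessment: it is incoherent once some bet has negative gain in
  every possible case. The witness attains the maximal gain, which exists because the gains form a
  finite nonempty set.\<close>

lemma coherent_gain_nonneg:
  assumes "coherent F p" "J \<noteq> {}" "J \<subseteq> {..<length F}"
  obtains v where "possible (events F J) v" "\<exists>j\<in>J. v (hyp (F ! j))" "gain F p J s v \<ge> 0"
proof -
  have fin: "finite J"
    using assms(3) finite_subset by blast
  obtain j where j: "j \<in> J" using assms(2) by blast
  have "gain_values F p J s \<noteq> {}"
    using assms(1,3) j fin unfolding coherent_def by (intro gain_values_nonempty) auto
  then have "Max (gain_values F p J s) \<in> gain_values F p J s"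
    using finite_gain_values[OF fin] by (rule Max_in[rotated])
  moreover have "0 \<le> Max (gain_values F p J s)"
    using assms unfolding coherent_def by blast
  ultimately obtain v where "possible (events F J) v" "\<exists>j\<in>J. v (hyp (F ! j))"
    "0 \<le> gain F p J s v"
    unfolding gain_values_def by (smt (verit) imageE mem_Collect_eq)
  then show thesis by (rule that)
qed

text \<open>Coherence from a probability distribution: the weighted mean of the gains over the cases in
  which some conditioning event is true is zero, so the extreme gains have opposite signs. Because
  every conditioning event has positive weight, one distribution serves all subfamilies \<open>J\<close>; the
  weights need not be normalised.\<close>

lemma coherent_if_distribution:
  fixes F :: "'a::boolean_algebra cond_event list" and w :: "'b \<Rightarrow> real"
  assumes len: "length p = length F"
    and fin: "finite W"
    and poss: "\<And>i. i \<in> W \<Longrightarrow> possible (events F {..<length F}) (v i)"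
    and nonneg: "\<And>i. i \<in> W \<Longrightarrow> 0 \<le> w i"
    and pos: "\<And>j. j < length F \<Longrightarrow> 0 < (\<Sum>i\<in>W. w i * of_bool (v i (hyp (F ! j))))"
    and fair: "\<And>j. j < length F \<Longrightarrow>
      (\<Sum>i\<in>W. w i * (of_bool (v i (hyp (F ! j))) * (of_bool (v i (ev (F ! j))) - p ! j))) = 0"
  shows "coherent F p"
  unfolding coherent_def
proof (intro conjI allI impI)
  show "hyp (F ! j) \<noteq> \<bottom>" if j: "j < length F" for j
  proof -
    have "\<exists>i\<in>W. v i (hyp (F ! j))"
    proof (rule ccontr)
      assume "\<not> ?thesis"
      then have "(\<Sum>i\<in>W. w i * of_bool (v i (hyp (F ! j)))) = 0"
        by (intro sum.neutral) auto
      with pos[OF j] show False by simp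
    qed
    then obtain i where "i \<in> W" "v i (hyp (F ! j))" by blast
    then show ?thesis
      using poss possible_true_nonbot[of "events F {..<length F}" "v i"] j by auto
  qed
next
  fix J :: "nat set" and s :: "nat \<Rightarrow> real"
  assume J: "J \<noteq> {} \<and> J \<subseteq> {..<length F}"
  then have finJ: "finite J" using finite_subset by blast
  let ?G = "gain_values F p J s"
  define g where "g i = gain F p J s (v i)" for i
  define D where "D = {i\<in>W. \<exists>j\<in>J. v i (hyp (F ! j))}"
  have D: "D \<subseteq> W" "finite D" using fin unfolding D_def by auto
  have "(\<Sum>i\<in>W. w i * g i) = (\<Sum>j\<in>J. s j * (\<Sum>i\<in>W. w i *
      (of_bool (v i (hyp (F ! j))) * (of_bool (v i (ev (F ! j))) - p ! j))))"
    unfolding g_def gain_def sum_distrib_left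
    by (subst sum.swap) (intro sum.cong refl, simp add: mult_ac)
  also have "\<dots> = 0"
    using J fair by (intro sum.neutral) auto
  finally have "(\<Sum>i\<in>W. w i * g i) = 0" .
  moreover have "(\<Sum>i\<in>D. w i * g i) = (\<Sum>i\<in>W. w i * g i)"
    using fin D(1) by (intro sum.mono_neutral_left) (auto simp: D_def g_def gain_def)
  ultimately have mean: "(\<Sum>i\<in>D. w i * g i) = 0" by simp
  obtain j where j: "j \<in> J" using J by blast
  have "0 < (\<Sum>i\<in>W. w i * of_bool (v i (hyp (F ! j))))"
    using pos j J by auto
  also have "\<dots> = (\<Sum>i\<in>D. w i * of_bool (v i (hyp (F ! j))))"
    using fin D(1) j by (intro sum.mono_neutral_right) (auto simp: D_def)
  also have "\<dots> \<le> (\<Sum>i\<in>D. w i)"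
    using nonneg D(1) by (intro sum_mono) auto
  finally have mass: "0 < (\<Sum>i\<in>D. w i)" .
  have "g i \<in> ?G" if "i \<in> D" for i
  proof -
    have "i \<in> W" using that D(1) by blast
    have "possible (events F J) (v i)"
      by (rule possible_antimono[OF poss[OF \<open>i \<in> W\<close>]]) (use J in blast, use j in blast, simp)
    then show ?thesis
      using that unfolding gain_values_def g_def D_def by blast
  qed
  then have bounds: "Min ?G \<le> g i" "g i \<le> Max ?G" if "i \<in> D" for i
    using Min_le[OF finite_gain_values[OF finJ]] Max_ge[OF finite_gain_values[OF finJ]] that
    by blast+
  have "(\<Sum>i\<in>D. w i) * Min ?G \<le> 0"
    unfolding mean[symmetric] sum_distrib_right
    using bounds nonneg D(1) by (intro sum_mono mult_left_mono) auto
  with mass show "Min ?G \<le> 0"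
    by (simp add: mult_le_0_iff)
  have "0 \<le> (\<Sum>i\<in>D. w i) * Max ?G"
    unfolding mean[symmetric] sum_distrib_right
    using bounds nonneg D(1) by (intro sum_mono mult_left_mono) auto
  with mass show "0 \<le> Max ?G"
    by (simp add: zero_le_mult_iff)
qed (rule len)

lemma coherent_prefix:
  assumes "coherent (F @ F') (p @ p')" "length p = length F"
  shows "coherent F p"
proof -
  have nth: "(F @ F') ! j = F ! j" "(p @ p') ! j = p ! j" if "j < length F" for j
    using that assms(2) by (simp_all add: nth_append)
  have "gain_values (F @ F') (p @ p') J s = gain_values F p J s" if "J \<subseteq> {..<length F}" for J s
  proof -
    have *: "(F @ F') ! j = F ! j \<and> (p @ p') ! j = p ! j" if "j \<in> J" for j
      using nth \<open>J \<subseteq> _\<close> that by auto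
    then have "gain (F @ F') (p @ p') J s = gain F p J s"
      unfolding gain_def by (intro ext sum.cong) auto
    moreover have "events (F @ F') J = events F J"
      using * by auto
    ultimately show ?thesis
      unfolding gain_values_def using * by (auto intro!: image_cong)
  qed
  then have same: "gain_values F p J s = gain_values (F @ F') (p @ p') J s \<and>
      J \<subseteq> {..<length (F @ F')}" if "J \<subseteq> {..<length F}" for J s
    using that by auto
  show ?thesis
    unfolding coherent_def
  proof (intro conjI allI impI)
    show "hyp (F ! j) \<noteq> \<bottom>" if "j < length F" for j
    proof -
      have "hyp ((F @ F') ! j) \<noteq> \<bottom>"
        using assms(1) that unfolding coherent_def by simp
      then show ?thesis using nth(1)[OF that] by simp
    qed
  next
    fix J :: "nat set" and s :: "nat \<Rightarrow> real"
    assume J: "J \<noteq> {} \<and> J \<subseteq> {..<length F}"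
    then have "gain_values F p J s = gain_values (F @ F') (p @ p') J s"
      and "J \<subseteq> {..<length (F @ F')}"
      using same by blast+
    then show "Min (gain_values F p J s) \<le> 0" "0 \<le> Max (gain_values F p J s)"
      using assms(1) J unfolding coherent_def by simp_all
  qed (rule assms(2))
qed

text \<open>Betting on \<open>\<not> E|H\<close> at price \<open>1 - x\<close> with stake \<open>s\<close> is betting on \<open>E|H\<close> at price \<open>x\<close> with
  stake \<open>- s\<close>. The two families mention different events, so an assignment for one has to be
  extended to the other before the gains can be compared.\<close>

lemma gain_values_negate_event:
  assumes "finite J"
    and "\<And>i. i \<noteq> k \<Longrightarrow> F' ! i = F ! i \<and> p' ! i = p ! i"
    and "ev (F' ! k) = - ev (F ! k)" "hyp (F' ! k) = hyp (F ! k)" "p' ! k = 1 - p ! k"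
  shows "gain_values F' p' J s \<subseteq> gain_values F p J (s(k := - s k))"
proof
  fix x assume "x \<in> gain_values F' p' J s"
  then obtain v where v: "possible (events F' J) v" "\<exists>j\<in>J. v (hyp (F' ! j))"
    and x: "x = gain F' p' J s v"
    unfolding gain_values_def by blast
  have "events F' J \<noteq> {}" using v(2) by blast
  then obtain v' where v': "possible (events F' J \<union> events F J) v'"
    and eq: "\<And>a. a \<in> events F' J \<Longrightarrow> v' a = v a"
    using possible_extend[OF v(1), of "events F J"] assms(1) by auto
  have neg: "v' (- ev (F ! k)) \<longleftrightarrow> \<not> v' (ev (F ! k))" if "k \<in> J"
    using possible_uminus[OF v', of "ev (F ! k)"] assms(1,3) that by force
  have hyps: "hyp (F' ! j) = hyp (F ! j)" for j
    using assms(2,4) by (cases "j = k") auto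
  have "x = gain F' p' J s v'"
    unfolding x using eq by (rule gain_cong[symmetric])
  also have "\<dots> = gain F p J (s(k := - s k)) v'"
    unfolding gain_def
  proof (rule sum.cong)
    fix j assume "j \<in> J"
    then show "s j * of_bool (v' (hyp (F' ! j))) * (of_bool (v' (ev (F' ! j))) - p' ! j) =
      (s(k := - s k)) j * of_bool (v' (hyp (F ! j))) * (of_bool (v' (ev (F ! j))) - p ! j)"
      using neg assms(2-5) by (cases "j = k") (auto simp: right_diff_distrib)
  qed simp
  finally have "x = gain F p J (s(k := - s k)) v'" .
  moreover have "possible (events F J) v'"
    using v(2) assms(1) by (intro possible_antimono[OF v']) auto
  moreover have "\<exists>j\<in>J. v' (hyp (F ! j))"
    using v(2) eq hyps by fastforce
  ultimately show "x \<in> gain_values F p J (s(k := - s k))"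
    unfolding gain_values_def by blast
qed

lemma coherent_negate_event:
  assumes "k < length F" "length p = length F"
  shows "coherent (F[k := - ev (F ! k) given hyp (F ! k)]) (p[k := 1 - p ! k]) \<longleftrightarrow> coherent F p"
proof -
  let ?F = "F[k := - ev (F ! k) given hyp (F ! k)]" and ?p = "p[k := 1 - p ! k]"
  have eq: "gain_values ?F ?p J s = gain_values F p J (s(k := - s k))" if "finite J" for J s
  proof
    show "gain_values ?F ?p J s \<subseteq> gain_values F p J (s(k := - s k))"
      using assms that by (intro gain_values_negate_event) auto
    have "gain_values F p J (s(k := - s k))
        \<subseteq> gain_values ?F ?p J ((s(k := - s k))(k := - (s(k := - s k)) k))"
      using assms that by (intro gain_values_negate_event) auto
    then show "gain_values F p J (s(k := - s k)) \<subseteq> gain_values ?F ?p J s"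
      by simp
  qed
  have hyps: "hyp (?F ! j) = hyp (F ! j)" for j
    using assms(1) by (cases "j = k") auto
  have fin: "finite J" if "J \<subseteq> {..<length F}" for J
    using that finite_subset by blast
  let ?Q = "\<lambda>J s. Min (gain_values F p J s) \<le> 0 \<and> 0 \<le> Max (gain_values F p J s)"
  have flip: "(\<forall>s. ?Q J (s(k := - s k))) \<longleftrightarrow> (\<forall>s. ?Q J s)" for J
  proof
    assume *: "\<forall>s. ?Q J (s(k := - s k))"
    show "\<forall>s. ?Q J s"
    proof
      fix s :: "nat \<Rightarrow> real"
      show "?Q J s" using *[rule_format, of "s(k := - s k)"] by simp
    qed
  qed blast
  have "coherent ?F ?p \<longleftrightarrow> length p = length F \<and> (\<forall>j<length F. hyp (F ! j) \<noteq> \<bottom>) \<and>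
      (\<forall>J. J \<noteq> {} \<and> J \<subseteq> {..<length F} \<longrightarrow> (\<forall>s. ?Q J (s(k := - s k))))"
    unfolding coherent_def length_list_update hyps using eq fin by metis
  also have "\<dots> \<longleftrightarrow> coherent F p"
    unfolding flip coherent_def by blast
  finally show ?thesis .
qed

section \<open>The first figure\<close>

text \<open>If \<open>z < y\<close>, unit bets on the first two premises and against the conclusion cost the
  bettor at least \<open>y - z\<close> when \<open>S\<close> is true, but nothing need be lost when \<open>S\<close> is false. Adding
  a bet on \<open>S|S \<or> M\<close> with stake \<open>y - z\<close> spreads the loss: the total gain is
  \<open>- (y - z) t - P(1 - M)\<close> on \<open>S\<close> and \<open>- (y - z) t - M(1 - P)\<close> on \<open>\<not> S\<close>, negative throughout.\<close>

lemma syllogism_lower_bound: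
  fixes S M P :: "'a::boolean_algebra"
  assumes coh: "coherent [P given M, M given S, S given (S \<squnion> M), P given S] [1, y, t, z]"
    and "t > 0"
  shows "y \<le> z"
proof (rule ccontr)
  let ?F = "[P given M, M given S, S given (S \<squnion> M), P given S]"
  assume "\<not> y \<le> z"
  then have less: "0 < (y - z) * t" using \<open>t > 0\<close> by simp
  have J: "{..<length ?F} = {0, 1, 2, 3}" by auto
  obtain v where v: "possible (events ?F {..<length ?F}) v"
    "\<exists>j\<in>{..<length ?F}. v (hyp (?F ! j))"
    "gain ?F [1, y, t, z] {..<length ?F} ((!) [1, 1, y - z, -1]) v \<ge> 0"
    using coherent_gain_nonneg[OF coh, of "{..<length ?F}"] by auto
  have sup: "v (S \<squnion> M) \<longleftrightarrow> v S \<or> v M"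
    using v(1) by (rule possible_sup) (unfold J, auto)
  have "v S \<or> v M"
    using v(2) unfolding J by (auto simp: sup)
  moreover have "0 \<le> of_bool (v M) * (of_bool (v P) - 1) + of_bool (v S) * (of_bool (v M) - y)
      + (y - z) * of_bool (v S \<or> v M) * (of_bool (v S) - t)
      - of_bool (v S) * (of_bool (v P) - z)"
    using v(3) unfolding J gain_def by (simp add: sup eval_nat_numeral)
  ultimately show False
    using less by (cases "v S"; cases "v M"; cases "v P") (simp_all add: algebra_simps)
qed

text \<open>The weights \<open>y\<close>, \<open>z - y\<close> and \<open>1 - z\<close> distribute unit mass over the constituents in \<open>S\<close>; a
  further unit on the constituent \<open>\<not> S M P\<close> keeps \<open>M\<close> positive even when \<open>y = 0\<close>, and gives
  \<open>S|S \<or> M\<close> the value one half.\<close>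

lemma coherent_syllogism:
  fixes S M P :: "'a::boolean_algebra"
  assumes indep: "logically_independent3 S M P" and "0 \<le> y" "y \<le> z" "z \<le> 1"
  shows "coherent [P given M, M given S, S given (S \<squnion> M), P given S] [1, y, 1/2, z]"
proof -
  let ?F = "[P given M, M given S, S given (S \<squnion> M), P given S]"
  let ?A = "{S, M, P, S \<squnion> M}"
  let ?W = "{(True, True, True), (True, False, True), (True, False, False), (False, True, True)}"
  define w where "w = (\<lambda>(a, b, c).
    if a \<and> b \<and> c then y else if a \<and> \<not> b \<and> c then z - y else if a then 1 - z else 1)"
  have "\<exists>v. possible ?A v \<and> v S = a \<and> v M = b \<and> v P = c \<and> v (S \<squnion> M) = (a \<or> b)" for a b c
  proof -
    let ?x = "(if a then S else - S) \<sqinter> (if b then M else - M) \<sqinter> (if c then P else - P)"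
    have "?x \<noteq> \<bottom>"
      using indep unfolding logically_independent3_def by auto
    then obtain v where v: "possible ?A v"
      "\<And>e. e \<in> ?A \<Longrightarrow> ?x \<le> e \<Longrightarrow> v e" "\<And>e. e \<in> ?A \<Longrightarrow> ?x \<le> - e \<Longrightarrow> \<not> v e"
      using possible_deciding[of ?A ?x] by blast
    have le: "?x \<le> (if a then S else - S)" "?x \<le> (if b then M else - M)"
      "?x \<le> (if c then P else - P)"
      by (auto intro: le_infI1 le_infI2)
    have "v S = a" "v M = b" "v P = c"
      using v(2,3)[of S] v(2,3)[of M] v(2,3)[of P] le by (metis insertCI)+
    moreover have "v (S \<squnion> M) \<longleftrightarrow> v S \<or> v M"
      using v(1) by (rule possible_sup) auto
    ultimately show ?thesis using v(1) by blast
  qed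
  then obtain f where f: "\<And>a b c. possible ?A (f a b c)" "\<And>a b c. f a b c S = a"
    "\<And>a b c. f a b c M = b" "\<And>a b c. f a b c P = c" "\<And>a b c. f a b c (S \<squnion> M) = (a \<or> b)"
    by metis
  have J: "{..<length ?F} = {0, 1, 2, 3}" by auto
  have A: "events ?F {..<length ?F} = ?A" unfolding J by auto
  have all: "(\<forall>j<length ?F. Q j) \<longleftrightarrow> Q 0 \<and> Q 1 \<and> Q 2 \<and> Q 3" for Q
    by (auto simp: less_Suc_eq eval_nat_numeral)
  show ?thesis
  proof (rule coherent_if_distribution[where W = ?W and w = w and v = "\<lambda>(a, b, c). f a b c"])
    show "possible (events ?F {..<length ?F}) ((\<lambda>(a, b, c). f a b c) i)" for i
      unfolding A using f(1) by (cases i) simp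
    show "0 \<le> w i" for i
      using assms(2-4) by (cases i) (simp add: w_def)
    show "0 < (\<Sum>i\<in>?W. w i * of_bool ((\<lambda>(a, b, c). f a b c) i (hyp (?F ! j))))"
      if "j < length ?F" for j
    proof -
      have "\<forall>j<length ?F. 0 < (\<Sum>i\<in>?W. w i * of_bool ((\<lambda>(a, b, c). f a b c) i (hyp (?F ! j))))"
        unfolding all using assms(2) by (simp add: f w_def eval_nat_numeral)
      then show ?thesis using that by blast
    qed
    show "(\<Sum>i\<in>?W. w i * (of_bool ((\<lambda>(a, b, c). f a b c) i (hyp (?F ! j)))
        * (of_bool ((\<lambda>(a, b, c). f a b c) i (ev (?F ! j))) - [1, y, 1/2, z] ! j))) = 0"
      if "j < length ?F" for j
    proof -
      have "\<forall>j<length ?F. (\<Sum>i\<in>?W. w i * (of_bool ((\<lambda>(a, b, c). f a b c) i (hyp (?F ! j)))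
        * (of_bool ((\<lambda>(a, b, c). f a b c) i (ev (?F ! j))) - [1, y, 1/2, z] ! j))) = 0"
        unfolding all by (simp add: f w_def eval_nat_numeral field_simps)
      then show ?thesis using that by blast
    qed
  qed auto
qed

lemma coherent_extensions_first_figure:
  "coherent_extensions [A, B, C] (listset [X, Y, T]) D =
     {z \<in> {0..1}. \<exists>x\<in>X. \<exists>y\<in>Y. \<exists>t\<in>T. coherent [A, B, C, D] [x, y, t, z]}"
proof -
  have "coherent [A, B, C] [x, y, t]" if "coherent [A, B, C, D] [x, y, t, z]" for x y t z
    using coherent_prefix[of "[A, B, C]" "[D]" "[x, y, t]" "[z]"] that by simp
  moreover have "listset [X, Y, T] = {[x, y, t] | x y t. x \<in> X \<and> y \<in> Y \<and> t \<in> T}"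
    by (auto simp: set_Cons_def)
  ultimately show ?thesis
    unfolding coherent_extensions_def by fastforce
qed

text \<open>Extending an assessment coherently presupposes a coherent assessment of the premises, so
  the g-coherence demanded of an inference can be read off from its set of coherent extensions.\<close>

lemma g_coherent_if_extension:
  assumes "coherent_extensions F (listset Xs) C \<noteq> {}" "length Xs = length F"
    and "\<And>X. X \<in> set Xs \<Longrightarrow> X \<subseteq> {0..1}"
  shows "g_coherent F (listset Xs)"
proof -
  have "length p = length Xs \<and> set p \<subseteq> \<Union> (set Xs)" if "p \<in> listset Xs" for p
    using that by (induction Xs arbitrary: p) (fastforce simp: set_Cons_def)+
  then show ?thesis
    using assms unfolding g_coherent_def imprecise_assessment_def coherent_extensions_def
    by fastforce
qed

lemma coherent_extensions_affirmative:
  fixes S M P :: "'a::boolean_algebra"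
  assumes "logically_independent3 S M P" "Y \<subseteq> {0..1}"
  shows "coherent_extensions [P given M, M given S, S given (S \<squnion> M)]
      (listset [{1}, Y, {0<..1}]) (P given S) = {z. z \<le> 1 \<and> (\<exists>y\<in>Y. y \<le> z)}" (is "_ = ?R")
proof -
  have "z \<in> ?R \<longleftrightarrow> z \<in> {0..1} \<and> (\<exists>y\<in>Y. \<exists>t\<in>{0<..1}.
      coherent [P given M, M given S, S given (S \<squnion> M), P given S] [1, y, t, z])" for z
  proof
    assume "z \<in> ?R"
    then obtain y where y: "z \<le> 1" "y \<in> Y" "y \<le> z" by blast
    with assms(2) have "0 \<le> y" by auto
    with y have "coherent [P given M, M given S, S given (S \<squnion> M), P given S] [1, y, 1/2, z]"
      by (intro coherent_syllogism assms(1))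
    moreover have "(1/2 :: real) \<in> {0<..1}" by simp
    ultimately show "z \<in> {0..1} \<and> (\<exists>y\<in>Y. \<exists>t\<in>{0<..1}.
      coherent [P given M, M given S, S given (S \<squnion> M), P given S] [1, y, t, z])"
      using y \<open>0 \<le> y\<close> by (intro conjI bexI[of _ y] bexI[of _ "1/2"]) simp_all
  next
    assume "z \<in> {0..1} \<and> (\<exists>y\<in>Y. \<exists>t\<in>{0<..1}.
      coherent [P given M, M given S, S given (S \<squnion> M), P given S] [1, y, t, z])"
    then show "z \<in> ?R"
      using syllogism_lower_bound by fastforce
  qed
  then show ?thesis
    unfolding coherent_extensions_first_figure by blast
qed

lemma coherent_extensions_negative:
  fixes S M P :: "'a::boolean_algebra"
  assumes "logically_independent3 S M P" "Y \<subseteq> {0..1}"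
  shows "coherent_extensions [P given M, M given S, S given (S \<squnion> M)]
      (listset [{0}, Y, {0<..1}]) (- P given S) = {z. z \<le> 1 \<and> (\<exists>y\<in>Y. y \<le> z)}"
proof -
  have "logically_independent3 S M (- P)"
    using assms(1) unfolding logically_independent3_def by auto
  note affirm = coherent_extensions_affirmative[OF this assms(2)]
  have "coherent [- P given M, B, C, D] [1, y, t, z] \<longleftrightarrow> coherent [P given M, B, C, D] [0, y, t, z]"
    for B C D y t z
    using coherent_negate_event[of 0 "[P given M, B, C, D]" "[0, y, t, z]"] by simp
  with affirm show ?thesis
    unfolding coherent_extensions_first_figure by simp
qed

lemma coherent_extensions_negated_conclusion:
  "coherent_extensions [A, B, C] (listset [X, Y, T]) (E given H) =
     {z. 1 - z \<in> coherent_extensions [A, B, C] (listset [X, Y, T]) (- E given H)}"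
proof -
  have "coherent [A, B, C, - E given H] [x, y, t, 1 - z] \<longleftrightarrow>
      coherent [A, B, C, E given H] [x, y, t, z]" for x y t z
    using coherent_negate_event[of 3 "[A, B, C, E given H]" "[x, y, t, z]"]
    by (simp add: eval_nat_numeral)
  then show ?thesis
    unfolding coherent_extensions_first_figure by auto
qed

theorem mainTheorem5:
  fixes S M P :: "'a::boolean_algebra"
  assumes "logically_independent3 S M P"
  (* in order: Barbara, Barbari (two conjuncts), Darii, Celarent, Celaront (two conjuncts), Ferio *)
  shows
    "strictly_valid [P given M, M given S, S given (S \<squnion> M)]
       (listset [{1}, {1}, {0<..1}]) (P given S) {1} \<and>
     valid [P given M, M given S, S given (S \<squnion> M)]
       (listset [{1}, {1}, {0<..1}]) (P given S) {0<..1} \<and>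
     \<not> strictly_valid [P given M, M given S, S given (S \<squnion> M)]
       (listset [{1}, {1}, {0<..1}]) (P given S) {0<..1} \<and>
     strictly_valid [P given M, M given S, S given (S \<squnion> M)]
       (listset [{1}, {0<..1}, {0<..1}]) (P given S) {0<..1} \<and>
     strictly_valid [P given M, M given S, S given (S \<squnion> M)]
       (listset [{0}, {1}, {0<..1}]) (P given S) {0} \<and>
     valid [P given M, M given S, S given (S \<squnion> M)]
       (listset [{0}, {1}, {0<..1}]) (- P given S) {0<..1} \<and>
     \<not> strictly_valid [P given M, M given S, S given (S \<squnion> M)]
       (listset [{0}, {1}, {0<..1}]) (- P given S) {0<..1} \<and>
     strictly_valid [P given M, M given S, S given (S \<squnion> M)]
       (listset [{0}, {0<..1}, {0<..1}]) (- P given S) {0<..1}"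
proof -
  let ?F = "[P given M, M given S, S given (S \<squnion> M)]"
  have Y: "{1} \<subseteq> {0..1 :: real}" "{0<..1} \<subseteq> {0..1 :: real}" by auto
  have sets: "{z. z \<le> 1 \<and> (\<exists>y\<in>{1}. y \<le> z)} = {1 :: real}"
    "{z. z \<le> 1 \<and> (\<exists>y\<in>{0<..1}. y \<le> z)} = {0<..1 :: real}" by force+
  note aff = coherent_extensions_affirmative[OF assms]
    and neg = coherent_extensions_negative[OF assms]
  have aff1: "coherent_extensions ?F (listset [{1}, {1}, {0<..1}]) (P given S) = {1}"
    and affpos: "coherent_extensions ?F (listset [{1}, {0<..1}, {0<..1}]) (P given S) = {0<..1}"
    and neg1: "coherent_extensions ?F (listset [{0}, {1}, {0<..1}]) (- P given S) = {1}"
    and negpos: "coherent_extensions ?F (listset [{0}, {0<..1}, {0<..1}]) (- P given S) = {0<..1}"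
    by (rule aff[OF Y(1), unfolded sets] aff[OF Y(2), unfolded sets]
        neg[OF Y(1), unfolded sets] neg[OF Y(2), unfolded sets])+
  have neg0: "coherent_extensions ?F (listset [{0}, {1}, {0<..1}]) (P given S) = {0}"
    by (subst coherent_extensions_negated_conclusion, unfold neg1) auto
  have g: "g_coherent ?F (listset [{1}, {1}, {0<..1}])"
    "g_coherent ?F (listset [{1}, {0<..1}, {0<..1}])"
    "g_coherent ?F (listset [{0}, {1}, {0<..1}])"
    by (rule g_coherent_if_extension[where C = "P given S"];
        auto simp: aff1 affpos neg0 simp del: listset.simps)+
  have g': "g_coherent ?F (listset [{0}, {0<..1}, {0<..1}])"
    by (rule g_coherent_if_extension[where C = "- P given S"];
        auto simp: negpos simp del: listset.simps)
  have "(1/2 :: real) \<in> {0<..1}" "(1/2 :: real) \<notin> {1}" by simp_all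
  then have "{1} \<noteq> {0<..1 :: real}" by blast
  then show ?thesis
    unfolding strictly_valid_def valid_def aff1 affpos neg1 negpos neg0
    using g g' by (auto simp del: listset.simps)
qed

end
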